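(* Let $k\ge1$ be an integer, let $\gamma>0$, and let $\mathcal{AM}_k$ be the set of alternating Motzkin paths of length $2k$. For $p\in\mathcal{AM}_k$ let $r(p)$ be its number of rises; for $0\le i\le k-1$ let $R_i(p)$ be the number of rises of $p$ from altitude $i$ to altitude $i+1$, and let $L_i(p)$ be the number of level steps of $p$ at altitude $i$ which occur at even-numbered steps; put $\vec R=(R_0,\dots,R_{k-1})$, $\vec L=(L_0,\dots,L_{k-1})$. Let $E$ denote expectation with respect to the probability distribution on $\mathcal{AM}_k$ giving each path $p$ probability proportional to $\gamma^{r(p)}$. Then \[ \| E[\vec{R}]\|^2_2+\gamma\,\| E[\vec{L}]\|_2^2 \;=\; \frac{1}{N_k(\gamma)^2} \sum_{p_1,p_2 \in \mathcal{AM}_k} \gamma^{r(p_1)+r(p_2)} \Big(\sum_{i=0}^{k-1} R_i(p_1)R_i(p_2) + \gamma \sum_{i=0}^{k-1} L_i(p_1)L_i(p_2) \Big) \;=\; \frac{N_{2k}(\gamma)}{N_k(\gamma)^2}-1, \] where $N_m(\gamma)=\sum_{r=0}^{m-1}\gamma^r\frac{1}{r+1}\binom{m}{r}\binom{m-1}{r}$ is the Narayana polynomial.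
   Context: A Motzkin path of length $2k$ is a lattice path of $2k$ steps, each a rise $(1,1)$, a fall $(1,-1)$ or a level step $(1,0)$, starting at $(0,0)$, ending at $(2k,0)$, never going below the $x$-axis. Steps are numbered $1,2,\dots,2k$ from left to right. An alternating Motzkin path is a Motzkin path in which rises occur only at even-numbered steps and falls occur only at odd-numbered steps. The altitude of a level step is the $y$-coordinate of its endpoints. The number of alternating Motzkin paths of length $2k$ with $r$ rises is $\frac{1}{r+1}\binom{k}{r}\binom{k-1}{r}$, so $\sum_{p\in\mathcal{AM}_k}\gamma^{r(p)}=N_k(\gamma)$. *)

theory Defs
  imports "HOL-Probability.Probability"
begin

text \<open>
  A lattice path starting at the origin is given by its list of steps; every step advances the
  \<open>x\<close>-coordinate by one, so \<open>altitude p j\<close> is the \<open>y\<close>-coordinate of the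
  path over \<open>x = j\<close>. Steps are numbered from 1, as in the mathematics, so that the
  parity conditions below read literally; step \<open>j\<close> joins \<open>x = j - 1\<close> to \<open>x = j\<close>.
\<close>

datatype path_step = Rise | Fall | Level

fun increment :: "path_step \<Rightarrow> int" where
  "increment Rise = 1"
| "increment Fall = - 1"
| "increment Level = 0"

definition altitude :: "path_step list \<Rightarrow> nat \<Rightarrow> int" where
  "altitude p j = (\<Sum>s\<leftarrow>take j p. increment s)"

definition step_no :: "path_step list \<Rightarrow> nat \<Rightarrow> path_step" where
  "step_no p j = p ! (j - 1)"

definition motzkin_path :: "nat \<Rightarrow> path_step list \<Rightarrow> bool" where
  "motzkin_path n p \<longleftrightarrow>
     length p = n \<and> altitude p n = 0 \<and> (\<forall>j\<le>n. 0 \<le> altitude p j)"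

definition alternating :: "path_step list \<Rightarrow> bool" where
  "alternating p \<longleftrightarrow>
     (\<forall>j\<in>{1..length p}. (step_no p j = Rise \<longrightarrow> even j) \<and> (step_no p j = Fall \<longrightarrow> odd j))"

definition AM :: "nat \<Rightarrow> path_step list set" where
  "AM k = {p. motzkin_path (2 * k) p \<and> alternating p}"

definition rises :: "path_step list \<Rightarrow> nat" where
  "rises p = card {j \<in> {1..length p}. step_no p j = Rise}"

definition R :: "nat \<Rightarrow> path_step list \<Rightarrow> nat" where
  "R i p = card {j \<in> {1..length p}. step_no p j = Rise \<and>
                   altitude p (j - 1) = int i \<and> altitude p j = int i + 1}"

definition L :: "nat \<Rightarrow> path_step list \<Rightarrow> nat" where
  "L i p = card {j \<in> {1..length p}. step_no p j = Level \<and> even j \<and>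
                   altitude p (j - 1) = int i \<and> altitude p j = int i}"

definition narayana :: "nat \<Rightarrow> real \<Rightarrow> real" where
  "narayana m \<gamma> =
     (\<Sum>r<m. \<gamma> ^ r * (1 / (real r + 1)) * real (m choose r) * real ((m - 1) choose r))"

text \<open>
  The weights are normalised by their actual sum, not by the Narayana polynomial, so that
  this is a probability distribution for every \<open>\<gamma> > 0\<close> by construction
  (see \<open>pmf_AM_pmf\<close>).
\<close>

definition AM_pmf :: "nat \<Rightarrow> real \<Rightarrow> path_step list pmf" where
  "AM_pmf k \<gamma> =
     embed_pmf (\<lambda>p. if p \<in> AM k then \<gamma> ^ rises p / (\<Sum>q\<in>AM k. \<gamma> ^ rises q) else 0)"

lemma finite_AM: "finite (AM k)"
proof -
  have "(UNIV :: path_step set) = {Rise, Fall, Level}"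
    using path_step.exhaust by blast
  then have "finite (UNIV :: path_step set)"
    by (metis finite.emptyI finite.insertI)
  then have "finite {p :: path_step list. set p \<subseteq> UNIV \<and> length p = 2 * k}"
    by (rule finite_lists_length_eq)
  then show ?thesis
    by (rule rev_finite_subset) (auto simp: AM_def motzkin_path_def)
qed

lemma AM_nonempty: "AM k \<noteq> {}"
proof -
  have "altitude (replicate (2 * k) Level) j = 0" for j
    by (simp add: altitude_def sum_list_replicate map_replicate)
  then have "replicate (2 * k) Level \<in> AM k"
    by (auto simp: AM_def motzkin_path_def alternating_def step_no_def nth_replicate)
  then show ?thesis by blast
qed

lemma pmf_AM_pmf:
  assumes "\<gamma> > 0"
  shows "pmf (AM_pmf k \<gamma>) p =
           (if p \<in> AM k then \<gamma> ^ rises p / (\<Sum>q\<in>AM k. \<gamma> ^ rises q) else 0)"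
proof -
  let ?Z = "\<Sum>q\<in>AM k. \<gamma> ^ rises q"
  let ?f = "\<lambda>p. if p \<in> AM k then \<gamma> ^ rises p / ?Z else 0"
  have Z: "?Z > 0"
    using assms by (intro sum_pos finite_AM AM_nonempty) auto
  have nn: "0 \<le> ?f q" for q
    using assms Z by simp
  have "(\<integral>\<^sup>+q. ennreal (?f q) \<partial>count_space UNIV) = (\<Sum>q\<in>AM k. ennreal (?f q))"
    by (rule nn_integral_count_space'[OF finite_AM]) auto
  also have "\<dots> = ennreal (\<Sum>q\<in>AM k. ?f q)"
    using nn by (rule sum_ennreal)
  also have "(\<Sum>q\<in>AM k. ?f q) = 1"
    using Z by (simp flip: sum_divide_distrib)
  finally have "(\<integral>\<^sup>+q. ennreal (?f q) \<partial>count_space UNIV) = 1"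
    by simp
  then show ?thesis
    unfolding AM_pmf_def using nn by (subst pmf_embed_pmf) auto
qed

end

theory Submission
  imports Defs "HOL-Computational_Algebra.Formal_Power_Series"
begin

text \<open>
  Two consecutive steps of an alternating path (an odd one, then an even one) act on the altitude by
  the Jacobi matrix \<open>J\<close> with rises weighted \<open>\<gamma>\<close>, falls weighted 1, and diagonal 1 at
  altitude 0 and \<open>1 + \<gamma>\<close> elsewhere. Let \<open>c k s\<close> be the weight of the \<open>J\<close>-walks of \<open>k\<close> steps
  from \<open>s\<close> to 0. Cutting a path at the marked step gives
  \<open>\<Sum>p. \<gamma> ^ r(p) * R\<^sub>i(p) = \<gamma> ^ (i + 1) * c k (2 * i + 2)\<close> and
  \<open>\<Sum>p. \<gamma> ^ r(p) * L\<^sub>i(p) = \<gamma> ^ i * c k (2 * i + 1)\<close>, because the generating function of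
  \<open>c k s\<close> in \<open>k\<close> is \<open>(1 + W) * W ^ s\<close> with \<open>W = z * (1 + W) * (1 + \<gamma> * W)\<close>. The left-hand side
  is therefore \<open>\<Sum>s=1..2*k. \<gamma> ^ s * (c k s)\<^sup>2\<close> up to normalisation. Since \<open>J\<close> is self-adjoint
  for the weights \<open>\<gamma> ^ s\<close>, including \<open>s = 0\<close> turns this sum into \<open>c (2 * k) 0 = N\<^sub>2\<^sub>k(\<gamma>)\<close>.
\<close>

section \<open>Walks of the Jacobi matrix and its self-adjointness\<close>

definition jacobi :: "real \<Rightarrow> (nat \<Rightarrow> real) \<Rightarrow> nat \<Rightarrow> real" where
  "jacobi \<gamma> u s =
     (if s = 0 then u 0 + \<gamma> * u 1 else u (s - 1) + (1 + \<gamma>) * u s + \<gamma> * u (s + 1))"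

primrec walk :: "real \<Rightarrow> nat \<Rightarrow> nat \<Rightarrow> real" where
  "walk \<gamma> 0 = (\<lambda>s. if s = 0 then 1 else 0)"
| "walk \<gamma> (Suc n) = jacobi \<gamma> (walk \<gamma> n)"

lemma walk_Suc_0: "walk \<gamma> (Suc n) 0 = walk \<gamma> n 0 + \<gamma> * walk \<gamma> n (Suc 0)"
  by (simp add: jacobi_def)

lemma walk_Suc_Suc:
  "walk \<gamma> (Suc n) (Suc s) =
     walk \<gamma> n s + (1 + \<gamma>) * walk \<gamma> n (Suc s) + \<gamma> * walk \<gamma> n (Suc (Suc s))"
  by (simp add: jacobi_def)

lemma walk_eq_0: "n < s \<Longrightarrow> walk \<gamma> n s = 0"
  by (induction n arbitrary: s) (auto simp: jacobi_def)

text \<open>A discrete Green identity: diagonal terms cancel, and the rest of the summand is a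
  difference of boundary terms at \<open>s + 1\<close> and \<open>s\<close>, so only the one at
  \<open>K + 1\<close> survives.\<close>

lemma jacobi_telescope:
  "(\<Sum>s\<le>K. \<gamma> ^ s * (jacobi \<gamma> u s * v s - u s * jacobi \<gamma> v s)) =
     \<gamma> ^ Suc K * (u (Suc K) * v K - u K * v (Suc K))"
  by (induction K) (auto simp: jacobi_def algebra_simps)

text \<open>The boundary term dies because \<open>u\<close> vanishes at both \<open>K\<close> and
  \<open>Suc K\<close>.\<close>

lemma jacobi_self_adjoint:
  assumes "\<And>s. K \<le> s \<Longrightarrow> u s = 0"
  shows "(\<Sum>s\<le>K. \<gamma> ^ s * (jacobi \<gamma> u s * v s)) = (\<Sum>s\<le>K. \<gamma> ^ s * (u s * jacobi \<gamma> v s))"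
  using jacobi_telescope[of \<gamma> u v K] assms
  by (simp add: right_diff_distrib sum_subtractf)

text \<open>Duhamel's principle for the recursion \<open>x (m + 1) = J (x m) + src m\<close>, tested against a walk.\<close>

lemma jacobi_duhamel:
  assumes "\<And>h. x 0 h = 0" and "\<And>m h. x (Suc m) h = jacobi \<gamma> (x m) h + src m h"
    and "n + m < K"
  shows "(\<Sum>h\<le>K. \<gamma> ^ h * (walk \<gamma> n h * x m h)) =
    (\<Sum>j<m. \<Sum>h\<le>K. \<gamma> ^ h * (walk \<gamma> (n + j) h * src (m - 1 - j) h))"
  using assms(3)
proof (induction m arbitrary: n)
  case 0
  then show ?case by (simp add: assms)
next
  case (Suc m)
  have "(\<Sum>h\<le>K. \<gamma> ^ h * (walk \<gamma> n h * x (Suc m) h)) =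
      (\<Sum>h\<le>K. \<gamma> ^ h * (walk \<gamma> n h * jacobi \<gamma> (x m) h)) +
      (\<Sum>h\<le>K. \<gamma> ^ h * (walk \<gamma> n h * src m h))"
    by (simp add: assms algebra_simps sum.distrib)
  also have "(\<Sum>h\<le>K. \<gamma> ^ h * (walk \<gamma> n h * jacobi \<gamma> (x m) h)) =
      (\<Sum>h\<le>K. \<gamma> ^ h * (walk \<gamma> (Suc n) h * x m h))"
    using Suc.prems by (subst jacobi_self_adjoint[symmetric]) (auto simp: walk_eq_0)
  also have "\<dots> = (\<Sum>j<m. \<Sum>h\<le>K. \<gamma> ^ h * (walk \<gamma> (Suc n + j) h * src (m - 1 - j) h))"
    using Suc.prems by (intro Suc.IH) simp
  finally show ?case
    unfolding sum.lessThan_Suc_shift by simp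
qed

text \<open>Self-adjointness moves the matrix from the second walk to the first, one step at a time,
  until the second is the indicator of altitude 0. The bound on \<open>K\<close> keeps the first
  walk supported below \<open>K\<close> at every move.\<close>

lemma walk_orthogonality:
  assumes "n + m < K"
  shows "(\<Sum>s\<le>K. \<gamma> ^ s * (walk \<gamma> n s * walk \<gamma> m s)) = walk \<gamma> (n + m) 0"
  using assms
proof (induction m arbitrary: n)
  case 0
  have "(\<Sum>s\<le>K. \<gamma> ^ s * (walk \<gamma> n s * walk \<gamma> 0 s)) = (\<Sum>s\<le>K. if s = 0 then walk \<gamma> n 0 else 0)"
    by (rule sum.cong) auto
  then show ?case by simp
next
  case (Suc m)
  then have "(\<Sum>s\<le>K. \<gamma> ^ s * (walk \<gamma> n s * walk \<gamma> (Suc m) s)) =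
      (\<Sum>s\<le>K. \<gamma> ^ s * (walk \<gamma> (Suc n) s * walk \<gamma> m s))"
    using jacobi_self_adjoint[of K "walk \<gamma> n" \<gamma> "walk \<gamma> m"] by (auto simp: walk_eq_0)
  with Suc.IH[of "Suc n"] Suc.prems show ?case by simp
qed

section \<open>Generating functions of the walks\<close>

definition walk_fps :: "real \<Rightarrow> nat \<Rightarrow> real fps" where
  "walk_fps \<gamma> s = Abs_fps (\<lambda>n. walk \<gamma> n s)"

lemma walk_fps_0:
  "walk_fps \<gamma> 0 = 1 + fps_X * (walk_fps \<gamma> 0 + fps_const \<gamma> * walk_fps \<gamma> (Suc 0))" (is "_ = ?r")
proof (rule fps_ext)
  show "fps_nth (walk_fps \<gamma> 0) n = fps_nth ?r n" for n
    by (cases n) (simp_all add: walk_fps_def walk_Suc_0 del: walk.simps(2))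
qed

lemma walk_fps_Suc:
  "walk_fps \<gamma> (Suc s) = fps_X * (walk_fps \<gamma> s + fps_const (1 + \<gamma>) * walk_fps \<gamma> (Suc s)
     + fps_const \<gamma> * walk_fps \<gamma> (Suc (Suc s)))" (is "_ = ?r")
proof (rule fps_ext)
  show "fps_nth (walk_fps \<gamma> (Suc s)) n = fps_nth ?r n" for n
    by (cases n) (simp_all add: walk_fps_def walk_Suc_Suc del: walk.simps(2))
qed

text \<open>
  This is \<open>(1 + W) * W ^ s * ((1 + W) * W ^ t) = (1 + W) * W ^ (s + t) * (1 + W)\<close>. The defect
  \<open>D s t\<close> of the identity satisfies the homogeneous walk recursion, whence it vanishes.
\<close>

lemma walk_fps_mult:
  "walk_fps \<gamma> s * walk_fps \<gamma> t = walk_fps \<gamma> (s + t) + walk_fps \<gamma> (Suc (s + t))"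
proof -
  define D where "D s t = walk_fps \<gamma> s * walk_fps \<gamma> t - walk_fps \<gamma> (s + t) - walk_fps \<gamma> (Suc (s + t))"
    for s t
  have g: "fps_const (1 + \<gamma>) = 1 + fps_const \<gamma>"
    by (simp flip: fps_const_add)
  have D0: "D 0 t = fps_X * (D 0 t + fps_const \<gamma> * D 1 t)" for t
  proof -
    have "D 0 t - fps_X * (D 0 t + fps_const \<gamma> * D 1 t) =
       (walk_fps \<gamma> 0 - (1 + fps_X * (walk_fps \<gamma> 0 + fps_const \<gamma> * walk_fps \<gamma> (Suc 0)))) * walk_fps \<gamma> t
       - (walk_fps \<gamma> (Suc t) - fps_X * (walk_fps \<gamma> t + fps_const (1 + \<gamma>) * walk_fps \<gamma> (Suc t)
          + fps_const \<gamma> * walk_fps \<gamma> (Suc (Suc t))))"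
      unfolding g D_def by (simp add: algebra_simps)
    also have "\<dots> = 0"
      by (simp flip: walk_fps_0 walk_fps_Suc)
    finally show ?thesis by simp
  qed
  have DS: "D (Suc s) t =
      fps_X * (D s t + fps_const (1 + \<gamma>) * D (Suc s) t + fps_const \<gamma> * D (Suc (Suc s)) t)" for s t
  proof -
    let ?e = "\<lambda>s. walk_fps \<gamma> (Suc s) - fps_X * (walk_fps \<gamma> s + fps_const (1 + \<gamma>) * walk_fps \<gamma> (Suc s)
          + fps_const \<gamma> * walk_fps \<gamma> (Suc (Suc s)))"
    have "D (Suc s) t -
        fps_X * (D s t + fps_const (1 + \<gamma>) * D (Suc s) t + fps_const \<gamma> * D (Suc (Suc s)) t)
      = ?e s * walk_fps \<gamma> t - ?e (s + t) - ?e (Suc (s + t))"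
      unfolding D_def by (simp add: algebra_simps)
    also have "\<dots> = 0"
      by (simp flip: walk_fps_Suc)
    finally show ?thesis by simp
  qed
  have "fps_nth (D s t) n = 0" for s t n
  proof (induction n arbitrary: s t)
    case 0
    have "fps_nth (D 0 t) 0 = 0" for t
      by (subst D0) simp
    moreover have "fps_nth (D (Suc s) t) 0 = 0" for s t
      by (subst DS) simp
    ultimately show ?case
      by (cases s) simp_all
  next
    case (Suc n)
    show ?case
    proof (cases s)
      case 0
      then show ?thesis
        by (subst 0, subst D0) (simp add: Suc)
    next
      case (Suc s')
      show ?thesis
        by (subst Suc, subst DS) (simp add: Suc.IH)
    qed
  qed
  then have "D s t = 0" by (simp add: fps_eq_iff)
  then show ?thesis by (simp add: D_def algebra_simps)
qed

text \<open>Splitting the middle weight \<open>1 + \<gamma>\<close> in the recursion groups its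
  terms into two products of generating functions. This evaluates Duhamel's sum for a source at
  altitudes \<open>s\<close> and \<open>Suc s\<close>.\<close>

lemma walk_convolution:
  "(\<Sum>j<k. (walk \<gamma> j s + \<gamma> * walk \<gamma> j (Suc s)) * walk \<gamma> (k - 1 - j) t) = walk \<gamma> k (Suc (s + t))"
proof (cases k)
  case 0
  then show ?thesis by simp
next
  case (Suc n)
  have "walk_fps \<gamma> (Suc (s + t)) =
      fps_X * ((walk_fps \<gamma> s + fps_const \<gamma> * walk_fps \<gamma> (Suc s)) * walk_fps \<gamma> t)"
    by (subst walk_fps_Suc)
      (simp add: distrib_right mult.assoc walk_fps_mult algebra_simps flip: fps_const_add)
  then have "fps_nth (walk_fps \<gamma> (Suc (s + t))) k =
      fps_nth ((walk_fps \<gamma> s + fps_const \<gamma> * walk_fps \<gamma> (Suc s)) * walk_fps \<gamma> t) n"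
    by (simp add: Suc)
  also have "\<dots> = (\<Sum>j<k. (walk \<gamma> j s + \<gamma> * walk \<gamma> j (Suc s)) * walk \<gamma> (k - 1 - j) t)"
    unfolding fps_mult_nth[of "_ + _"]
    by (simp add: walk_fps_def Suc atLeast0AtMost lessThan_Suc_atMost)
  finally show ?thesis by (simp add: walk_fps_def)
qed

section \<open>Closed form of the walks and Narayana polynomials\<close>

text \<open>Weight of the paths of \<open>Suc n\<close> step pairs from \<open>s\<close> to 0 that
  may go below the axis but end with a level step: \<open>f + s\<close> falls among the odd steps,
  \<open>f\<close> rises among the even steps except the last.\<close>

definition binomial_sum :: "real \<Rightarrow> nat \<Rightarrow> nat \<Rightarrow> real" where
  "binomial_sum \<gamma> n s = (\<Sum>f\<le>n. \<gamma> ^ f * real (Suc n choose (f + s)) * real (n choose f))"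

text \<open>Pascal's rule on the last factor, with an index shift in one of the two halves.\<close>

lemma sum_choose_Suc:
  fixes \<gamma> :: real
  shows "(\<Sum>f\<le>Suc n. \<gamma> ^ f * a f * real (Suc n choose f)) =
    (\<Sum>f\<le>n. \<gamma> ^ f * (a f + \<gamma> * a (Suc f)) * real (n choose f))"
proof -
  have "(\<Sum>f\<le>Suc n. \<gamma> ^ f * a f * real (Suc n choose f)) =
      a 0 + (\<Sum>f\<le>n. \<gamma> ^ Suc f * a (Suc f) * real (n choose Suc f))
       + (\<Sum>f\<le>n. \<gamma> ^ Suc f * a (Suc f) * real (n choose f))"
    unfolding sum.atMost_Suc_shift by (simp add: algebra_simps sum.distrib)
  also have "a 0 + (\<Sum>f\<le>n. \<gamma> ^ Suc f * a (Suc f) * real (n choose Suc f)) =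
      (\<Sum>f\<le>Suc n. \<gamma> ^ f * a f * real (n choose f))"
    unfolding sum.atMost_Suc_shift by simp
  finally show ?thesis by (simp add: algebra_simps sum.distrib)
qed

text \<open>The difference of binomial sums is the count given by the reflection principle.\<close>

lemma walk_closed_form:
  "walk \<gamma> (Suc n) s = binomial_sum \<gamma> n s - \<gamma> * binomial_sum \<gamma> n (s + 2)"
proof (induction n arbitrary: s)
  case 0
  then show ?case
    by (cases s; cases "s - 1") (simp_all add: jacobi_def binomial_sum_def binomial_eq_0)
next
  case (Suc n)
  \<comment> \<open>Pascal's rule on both factors; the second argument must be positive for the
    first of them, so \<open>s = 0\<close> is treated apart.\<close>
  have rec: "binomial_sum \<gamma> (Suc n) (Suc s) = binomial_sum \<gamma> n s
      + (1 + \<gamma>) * binomial_sum \<gamma> n (Suc s) + \<gamma> * binomial_sum \<gamma> n (Suc (Suc s))" for s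
    unfolding binomial_sum_def
    by (subst sum_choose_Suc) (simp add: algebra_simps sum.distrib sum_distrib_left)
  show ?case
  proof (cases s)
    case (Suc s')
    then show ?thesis
      by (simp only: walk_Suc_Suc[of \<gamma> "Suc n"] Suc.IH rec add_Suc add_2_eq_Suc')
        (simp add: algebra_simps)
  next
    case 0
    \<comment> \<open>The second term of Pascal's rule; at \<open>f = 0\<close> truncated
      subtraction would give 1 instead of the required 0.\<close>
    define b where "b f = (if f = 0 then 0 else real (Suc n choose (f - 1)))" for f
    have b: "real (Suc (Suc n) choose f) = real (Suc n choose f) + b f" for f
      by (cases f) (simp_all add: b_def)
    have "binomial_sum \<gamma> (Suc n) 0 = binomial_sum \<gamma> n 0 + \<gamma> * binomial_sum \<gamma> n 1
       + (\<Sum>f\<le>n. \<gamma> ^ f * (b f + \<gamma> * b (Suc f)) * real (n choose f))"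
      unfolding binomial_sum_def
      by (subst sum_choose_Suc) (simp add: b algebra_simps sum.distrib sum_distrib_left
          del: binomial_Suc_Suc)
    \<comment> \<open>Folding the \<open>b\<close> terms back to \<open>Suc n\<close> allows an
      index shift, after which the other factor is expanded.\<close>
    also have "(\<Sum>f\<le>n. \<gamma> ^ f * (b f + \<gamma> * b (Suc f)) * real (n choose f)) =
        (\<Sum>f\<le>Suc n. \<gamma> ^ f * b f * real (Suc n choose f))"
      by (rule sum_choose_Suc[symmetric])
    also have "\<dots> = \<gamma> * (\<Sum>f\<le>n. \<gamma> ^ f * real (Suc n choose Suc f) * real (Suc n choose f))"
      unfolding sum.atMost_Suc_shift
      by (simp add: b_def sum_distrib_left mult_ac del: binomial_Suc_Suc)
    also have "(\<Sum>f\<le>n. \<gamma> ^ f * real (Suc n choose Suc f) * real (Suc n choose f)) =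
        (\<Sum>f\<le>Suc n. \<gamma> ^ f * real (Suc n choose Suc f) * real (Suc n choose f))"
      by (simp add: binomial_eq_0 del: binomial_Suc_Suc)
    also have "\<dots> = binomial_sum \<gamma> n 1 + \<gamma> * binomial_sum \<gamma> n 2"
      unfolding binomial_sum_def
      by (subst sum_choose_Suc) (simp add: algebra_simps sum.distrib sum_distrib_left
          del: binomial_Suc_Suc)
    finally show ?thesis
      using rec[of 1] unfolding 0 walk_Suc_0[of \<gamma> "Suc n"] Suc.IH
      by (simp add: numeral_2_eq_2 numeral_3_eq_3 algebra_simps)
  qed
qed

lemma choose_Suc_absorb:
  "real (Suc f) * real (m choose Suc f) = (real m - real f) * real (m choose f)"
proof (cases "f \<le> m")
  case True
  have "Suc f * (m choose Suc f) = (m - f) * (m choose f)"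
    using binomial_absorb_comp[of m f] binomial_absorption[of f m] by simp
  then have "real (Suc f * (m choose Suc f)) = real ((m - f) * (m choose f))"
    by (rule arg_cong)
  then show ?thesis
    by (simp only: of_nat_mult of_nat_diff[OF True])
qed (simp add: binomial_eq_0)

text \<open>In the coefficient of \<open>\<gamma> ^ f\<close>, absorption makes the reflected
  product \<open>f / (f + 1)\<close> times the main one, leaving the Narayana factor
  \<open>1 / (f + 1)\<close>.\<close>

lemma walk_narayana: "walk \<gamma> (Suc n) 0 = narayana (Suc n) \<gamma>"
proof -
  have coeff: "1 / (real f + 1) * real (Suc n choose f) * real (n choose f) =
      real (Suc n choose f) * real (n choose f)
      - (if f = 0 then 0 else real (Suc n choose Suc f) * real (n choose (f - 1)))"
    if "f \<le> n" for f
  proof (cases f)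
    case 0
    then show ?thesis by simp
  next
    case (Suc g)
    have 1: "(real f + 1) * real (Suc n choose Suc f) = (real n + 1 - real f) * real (Suc n choose f)"
      using choose_Suc_absorb[of f "Suc n"] by (simp add: add_ac del: binomial_Suc_Suc)
    have 2: "real f * real (n choose f) = (real n + 1 - real f) * real (n choose g)"
      using choose_Suc_absorb[of g n] Suc by (simp add: add_ac del: binomial_Suc_Suc)
    have "(real f + 1) * (real (Suc n choose Suc f) * real (n choose g)) =
       real (Suc n choose f) * ((real n + 1 - real f) * real (n choose g))"
      using 1 by (simp only: mult.assoc[symmetric]) (simp only: mult_ac)
    also have "\<dots> = real f * (real (Suc n choose f) * real (n choose f))"
      unfolding 2[symmetric] by (rule mult.left_commute)
    finally show ?thesis
      using Suc by (simp add: field_simps del: binomial_Suc_Suc)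
  qed
  have "\<gamma> * binomial_sum \<gamma> n 2 =
      (\<Sum>f\<le>Suc n. \<gamma> ^ f * (if f = 0 then 0 else real (Suc n choose Suc f) * real (n choose (f - 1))))"
    unfolding sum.atMost_Suc_shift
    by (simp add: binomial_sum_def sum_distrib_left mult_ac del: binomial_Suc_Suc)
  then have "walk \<gamma> (Suc n) 0 = (\<Sum>f\<le>n. \<gamma> ^ f * (real (Suc n choose f) * real (n choose f)
      - (if f = 0 then 0 else real (Suc n choose Suc f) * real (n choose (f - 1)))))"
    by (simp add: walk_closed_form binomial_sum_def right_diff_distrib sum_subtractf mult_ac
        numeral_2_eq_2 binomial_eq_0 del: binomial_Suc_Suc walk.simps)
  also have "\<dots> = (\<Sum>f\<le>n. \<gamma> ^ f * (1 / (real f + 1) * real (Suc n choose f) * real (n choose f)))"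
    by (intro sum.cong refl arg_cong[where f = "\<lambda>x. _ * x"] coeff[symmetric]) simp
  also have "\<dots> = narayana (Suc n) \<gamma>"
    by (simp add: narayana_def lessThan_Suc_atMost mult_ac del: binomial_Suc_Suc)
  finally show ?thesis .
qed

section \<open>Recursive description of alternating paths and their step counts\<close>

text \<open>Starting altitude as a parameter, so that paths can be peeled off two steps at a time.\<close>

primrec paths :: "nat \<Rightarrow> nat \<Rightarrow> path_step list set" where
  "paths 0 h = (if h = 0 then {[]} else {})"
| "paths (Suc m) h =
     (\<lambda>p. Level # Level # p) ` paths m h \<union> (\<lambda>p. Level # Rise # p) ` paths m (h + 1) \<union>
     (if h = 0 then {} else
       (\<lambda>p. Fall # Level # p) ` paths m (h - 1) \<union> (\<lambda>p. Fall # Rise # p) ` paths m h)"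

definition rises_from :: "nat \<Rightarrow> nat \<Rightarrow> path_step list \<Rightarrow> nat" where
  "rises_from h i p = card {j \<in> {1..length p}. step_no p j = Rise \<and>
     int h + altitude p (j - 1) = int i \<and> int h + altitude p j = int i + 1}"

definition levels_from :: "nat \<Rightarrow> nat \<Rightarrow> path_step list \<Rightarrow> nat" where
  "levels_from h i p = card {j \<in> {1..length p}. step_no p j = Level \<and> even j \<and>
     int h + altitude p (j - 1) = int i \<and> int h + altitude p j = int i}"

lemma card_filter_Suc:
  "card {j \<in> {1..Suc n}. P j} = (if P 1 then 1 else 0) + card {j \<in> {1..n}. P (Suc j)}"
proof -
  have eq: "{j \<in> {1..Suc n}. P j} = (if P 1 then {1} else {}) \<union> Suc ` {j \<in> {1..n}. P (Suc j)}"
    (is "?A = ?B")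
  proof (rule set_eqI)
    show "x \<in> ?A \<longleftrightarrow> x \<in> ?B" for x
      by (cases x; cases "x = 1") (auto simp: image_iff)
  qed
  show ?thesis
    unfolding eq by (subst card_Un_disjoint) (auto simp: card_image)
qed

lemma altitude_0 [simp]: "altitude p 0 = 0"
  by (simp add: altitude_def)

lemma altitude_Cons_Suc [simp]: "altitude (s # p) (Suc j) = increment s + altitude p j"
  by (simp add: altitude_def)

lemma altitude_Cons: "j > 0 \<Longrightarrow> altitude (s # p) j = increment s + altitude p (j - 1)"
  by (cases j) simp_all

lemma step_no_Cons: "j > 0 \<Longrightarrow> step_no (s # p) (Suc j) = step_no p j"
  by (cases j) (simp_all add: step_no_def)

lemma step_no_Cons_1 [simp]: "step_no (s # p) (Suc 0) = s"
  by (simp add: step_no_def)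

lemma rises_Cons: "rises (s # p) = (if s = Rise then 1 else 0) + rises p"
  unfolding rises_def
  by (simp only: list.size add_Suc_right add_0_right card_filter_Suc)
    (auto simp: step_no_Cons intro!: arg_cong[where f = card])

lemma rises_from_Cons_Cons:
  assumes "int h + increment s + increment t = int h'"
  shows "rises_from h i (s # t # p) =
    (if s = Rise \<and> h = i then 1 else 0) +
    (if t = Rise \<and> int h + increment s = int i then 1 else 0) + rises_from h' i p"
  unfolding rises_from_def assms[symmetric]
  by (simp only: list.size add_Suc_right add_0_right card_filter_Suc)
    (auto simp: step_no_Cons altitude_Cons add.assoc intro!: arg_cong[where f = card])

text \<open>Removing two steps preserves the parity of positions, and of the two only
  \<open>t\<close> stands at an even one.\<close>

lemma levels_from_Cons_Cons:
  assumes "int h + increment s + increment t = int h'"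
  shows "levels_from h i (s # t # p) =
    (if t = Level \<and> int h + increment s = int i then 1 else 0) + levels_from h' i p"
  unfolding levels_from_def assms[symmetric]
  by (simp only: list.size add_Suc_right add_0_right card_filter_Suc)
    (auto simp: step_no_Cons altitude_Cons add.assoc intro!: arg_cong[where f = card])

lemma alternating_Cons_Cons:
  "alternating (s # t # p) \<longleftrightarrow> s \<noteq> Rise \<and> t \<noteq> Fall \<and> alternating p"
proof -
  have eq: "{1..Suc n} = insert 1 (Suc ` {1..n})" for n
    by auto
  have *: "(\<forall>j\<in>{1..Suc n}. P j) \<longleftrightarrow> P 1 \<and> (\<forall>j\<in>{1..n}. P (Suc j))"
    for n and P :: "nat \<Rightarrow> bool"
    unfolding eq by blast
  show ?thesis
    unfolding alternating_def
    by (simp only: list.size add_Suc_right add_0_right *) (auto simp: step_no_Cons)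
qed

lemma all_le_Suc_Suc: "(\<forall>j\<le>Suc (Suc n). P j) \<longleftrightarrow> P 0 \<and> P (Suc 0) \<and> (\<forall>j\<le>n. P (Suc (Suc j)))"
  by (metis Suc_le_mono not0_implies_Suc zero_le)

text \<open>Forbidding an initial fall at \<open>h = 0\<close> is exactly nonnegativity after the
  first step; the other conditions pass to the remaining path.\<close>

lemma paths_iff:
  "p \<in> paths m h \<longleftrightarrow> length p = 2 * m \<and> alternating p \<and> int h + altitude p (2 * m) = 0 \<and>
     (\<forall>j\<le>2 * m. 0 \<le> int h + altitude p j)"
proof (induction m arbitrary: h p)
  case 0
  then show ?case by (auto simp: alternating_def)
next
  case (Suc m)
  have dbl: "2 * Suc m = Suc (Suc (2 * m))" by simp
  show ?case
  proof (cases "\<exists>s t q. p = s # t # q")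
    case False
    then have "length p < 2"
      by (metis One_nat_def Suc_less_eq length_Cons less_2_cases_iff list.size(3) neq_Nil_conv zero_less_Suc
          less_numeral_extra(1) pos2)
    moreover have "p \<notin> paths (Suc m) h"
      using False by (auto split: if_splits)
    ultimately show ?thesis by auto
  next
    case True
    then obtain s t q where p: "p = s # t # q" by blast
    show ?thesis
    proof (cases "h = 0")
      case True
      then show ?thesis
        unfolding p dbl alternating_Cons_Cons all_le_Suc_Suc
        by (cases s; cases t) (auto simp: Suc.IH image_iff add_ac)
    next
      case False
      then obtain g where h: "h = Suc g" by (cases h) auto
      show ?thesis
        unfolding p dbl alternating_Cons_Cons all_le_Suc_Suc h
        by (cases s; cases t) (auto simp: Suc.IH image_iff add_ac)
    qed
  qed
qed

lemma AM_eq_paths: "AM k = paths k 0"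
  by (auto simp: AM_def motzkin_path_def paths_iff)

lemma finite_paths: "finite (paths m h)"
  by (induction m arbitrary: h) auto

section \<open>Weighted sums over paths\<close>

lemma sum_paths_Suc:
  "sum \<phi> (paths (Suc m) h) =
     (\<Sum>p\<in>paths m h. \<phi> (Level # Level # p)) + (\<Sum>p\<in>paths m (h + 1). \<phi> (Level # Rise # p)) +
     (if h = 0 then 0 else
       (\<Sum>p\<in>paths m (h - 1). \<phi> (Fall # Level # p)) + (\<Sum>p\<in>paths m h. \<phi> (Fall # Rise # p)))"
  for \<phi> :: "path_step list \<Rightarrow> real"
proof -
  have im: "sum \<phi> ((\<lambda>p. s # t # p) ` paths m g) = (\<Sum>p\<in>paths m g. \<phi> (s # t # p))" for s t g
    by (subst sum.reindex) (auto simp: inj_on_def)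
  show ?thesis
  proof (cases "h = 0")
    case True
    then show ?thesis
      by (simp, subst sum.union_disjoint) (auto simp: finite_paths im)
  next
    case False
    then show ?thesis
      by (simp, subst sum.union_disjoint, simp_all add: finite_paths im,
          (blast | (subst sum.union_disjoint; auto simp: finite_paths im))+)
  qed
qed

text \<open>A step pair is one application of \<open>jacobi\<close>: two level steps and a fall
  followed by a rise give the diagonal \<open>1 + \<gamma>\<close>, the latter pair being excluded
  at altitude 0.\<close>

lemma sum_paths_weight: "(\<Sum>p\<in>paths m h. \<gamma> ^ rises p) = walk \<gamma> m h"
proof (induction m arbitrary: h)
  case 0
  then show ?case by (simp add: rises_def cong: conj_cong)
next
  case (Suc m)
  show ?case
    unfolding sum_paths_Suc
    by (auto simp: rises_Cons jacobi_def Suc.IH algebra_simps simp flip: sum_distrib_left)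
qed

text \<open>
  A counted step starts at altitude \<open>i\<close>, reached from \<open>h = i\<close> by a level step or from \<open>h = i + 1\<close>
  by a fall; it has weight \<open>b\<close> and the path continues from altitude \<open>t\<close>.
\<close>

lemma sum_paths_count:
  fixes cnt :: "nat \<Rightarrow> path_step list \<Rightarrow> nat"
  assumes Nil: "cnt 0 [] = 0"
    and src: "\<And>m h. (\<Sum>p\<in>paths (Suc m) h. \<gamma> ^ rises p * real (cnt h p)) =
      jacobi \<gamma> (\<lambda>h. \<Sum>p\<in>paths m h. \<gamma> ^ rises p * real (cnt h p)) h +
      (if h = i \<or> h = Suc i then b * walk \<gamma> m t else 0)"
  shows "(\<Sum>p\<in>AM k. \<gamma> ^ rises p * real (cnt 0 p)) = b * \<gamma> ^ i * walk \<gamma> k (Suc (i + t))"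
proof -
  define x where "x m h = (\<Sum>p\<in>paths m h. \<gamma> ^ rises p * real (cnt h p))" for m h
  let ?s = "\<lambda>m h. if h = i \<or> h = Suc i then b * walk \<gamma> m t else 0"
  \<comment> \<open>Large enough to exceed \<open>k\<close> and to include both source
    altitudes.\<close>
  define K where "K = Suc (k + Suc i)"
  have inner: "(\<Sum>h\<le>K. \<gamma> ^ h * (walk \<gamma> j h * ?s m h)) =
     b * \<gamma> ^ i * ((walk \<gamma> j i + \<gamma> * walk \<gamma> j (Suc i)) * walk \<gamma> m t)" for j m
  proof -
    have "(\<Sum>h\<le>K. \<gamma> ^ h * (walk \<gamma> j h * ?s m h)) = (\<Sum>h\<in>{i, Suc i}. \<gamma> ^ h * (walk \<gamma> j h * ?s m h))"
      by (rule sum.mono_neutral_right) (auto simp: K_def)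
    then show ?thesis by (simp add: algebra_simps)
  qed
  \<comment> \<open>\<open>walk \<gamma> 0\<close> is the indicator of 0, so evaluation at 0 becomes
    a pairing with a walk.\<close>
  have "x k 0 = (\<Sum>h\<le>K. if h = 0 then x k 0 else 0)"
    by simp
  also have "\<dots> = (\<Sum>h\<le>K. \<gamma> ^ h * (walk \<gamma> 0 h * x k h))"
    by (rule sum.cong) auto
  also have "\<dots> = (\<Sum>j<k. \<Sum>h\<le>K. \<gamma> ^ h * (walk \<gamma> (0 + j) h * ?s (k - 1 - j) h))"
  proof (rule jacobi_duhamel)
    show "x 0 h = 0" for h
      by (simp add: x_def Nil)
    show "x (Suc m) h = jacobi \<gamma> (x m) h + ?s m h" for m h
      unfolding x_def[abs_def] by (rule src)
  qed (simp add: K_def)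
  also have "\<dots> = b * \<gamma> ^ i * walk \<gamma> k (Suc (i + t))"
    by (simp only: inner add_0 sum_distrib_left[symmetric] walk_convolution)
  finally show ?thesis by (simp add: x_def AM_eq_paths)
qed

text \<open>The counted rise has weight \<open>\<gamma>\<close> and leads to \<open>Suc i\<close>,
  whence \<open>b = \<gamma>\<close> and \<open>t = Suc i\<close>.\<close>

lemma sum_AM_R: "(\<Sum>p\<in>AM k. \<gamma> ^ rises p * real (R i p)) = \<gamma> ^ (i + 1) * walk \<gamma> k (2 * i + 2)"
proof -
  have "(\<Sum>p\<in>AM k. \<gamma> ^ rises p * real (rises_from 0 i p)) = \<gamma> * \<gamma> ^ i * walk \<gamma> k (Suc (i + Suc i))"
  proof (rule sum_paths_count)
    show "rises_from 0 i [] = 0" by (auto simp: rises_from_def card_eq_0_iff)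
    show "(\<Sum>p\<in>paths (Suc m) h. \<gamma> ^ rises p * real (rises_from h i p)) =
      jacobi \<gamma> (\<lambda>h. \<Sum>p\<in>paths m h. \<gamma> ^ rises p * real (rises_from h i p)) h +
      (if h = i \<or> h = Suc i then \<gamma> * walk \<gamma> m (Suc i) else 0)" for m h
    proof -
      have LL: "rises_from h i (Level # Level # p) = rises_from h i p" for p
        by (subst rises_from_Cons_Cons[where h' = h]) auto
      have LR: "rises_from h i (Level # Rise # p) = of_bool (h = i) + rises_from (Suc h) i p" for p
        by (subst rises_from_Cons_Cons[where h' = "Suc h"]) auto
      have FL: "rises_from h i (Fall # Level # p) = rises_from (h - 1) i p" if "h \<noteq> 0" for p
        using that by (subst rises_from_Cons_Cons[where h' = "h - 1"]) auto
      have FR: "rises_from h i (Fall # Rise # p) = of_bool (h = Suc i) + rises_from h i p"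
        if "h \<noteq> 0" for p
        using that by (subst rises_from_Cons_Cons[where h' = h]) auto
      show ?thesis
        unfolding sum_paths_Suc
        by (auto simp: rises_Cons jacobi_def LL LR FL FR algebra_simps sum.distrib
            sum_paths_weight simp flip: sum_distrib_left)
    qed
  qed
  then show ?thesis
    by (simp add: rises_from_def R_def mult_2)
qed

text \<open>A level step has weight 1 and stays at \<open>i\<close>, whence \<open>b = 1\<close> and
  \<open>t = i\<close>.\<close>

lemma sum_AM_L: "(\<Sum>p\<in>AM k. \<gamma> ^ rises p * real (L i p)) = \<gamma> ^ i * walk \<gamma> k (2 * i + 1)"
proof -
  have "(\<Sum>p\<in>AM k. \<gamma> ^ rises p * real (levels_from 0 i p)) = 1 * \<gamma> ^ i * walk \<gamma> k (Suc (i + i))"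
  proof (rule sum_paths_count)
    show "levels_from 0 i [] = 0" by (auto simp: levels_from_def card_eq_0_iff)
    show "(\<Sum>p\<in>paths (Suc m) h. \<gamma> ^ rises p * real (levels_from h i p)) =
      jacobi \<gamma> (\<lambda>h. \<Sum>p\<in>paths m h. \<gamma> ^ rises p * real (levels_from h i p)) h +
      (if h = i \<or> h = Suc i then 1 * walk \<gamma> m i else 0)" for m h
    proof -
      have LL: "levels_from h i (Level # Level # p) = of_bool (h = i) + levels_from h i p" for p
        by (subst levels_from_Cons_Cons[where h' = h]) auto
      have LR: "levels_from h i (Level # Rise # p) = levels_from (Suc h) i p" for p
        by (subst levels_from_Cons_Cons[where h' = "Suc h"]) auto
      have FL: "levels_from h i (Fall # Level # p) = of_bool (h = Suc i) + levels_from (h - 1) i p"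
        if "h \<noteq> 0" for p
        using that by (subst levels_from_Cons_Cons[where h' = "h - 1"]) auto
      have FR: "levels_from h i (Fall # Rise # p) = levels_from h i p" if "h \<noteq> 0" for p
        using that by (subst levels_from_Cons_Cons[where h' = h]) auto
      show ?thesis
        unfolding sum_paths_Suc
        by (auto simp: rises_Cons jacobi_def LL LR FL FR algebra_simps sum.distrib
            sum_paths_weight simp flip: sum_distrib_left)
    qed
  qed
  then show ?thesis
    by (simp add: levels_from_def L_def mult_2)
qed

section \<open>Sums of squares and expectations\<close>

text \<open>Orthogonality of \<open>walk \<gamma> k\<close> with itself: odd \<open>s\<close> give
  the level terms, positive even \<open>s\<close> the rise terms, and \<open>s = 0\<close> the
  subtracted square.\<close>

lemma sum_walk_squares:
  "(\<Sum>i<k. (\<gamma> ^ (i + 1) * walk \<gamma> k (2 * i + 2))\<^sup>2) + \<gamma> * (\<Sum>i<k. (\<gamma> ^ i * walk \<gamma> k (2 * i + 1))\<^sup>2)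
     = walk \<gamma> (2 * k) 0 - (walk \<gamma> k 0)\<^sup>2"
proof -
  have pair: "(\<Sum>s<2 * n. f (Suc s)) = (\<Sum>i<n. f (2 * i + 1) + f (2 * i + 2))"
    for f :: "nat \<Rightarrow> real" and n
    by (induction n) auto
  let ?f = "\<lambda>s. \<gamma> ^ s * (walk \<gamma> k s * walk \<gamma> k s)"
  have odd_term: "?f (2 * i + 1) = \<gamma> * (\<gamma> ^ i * walk \<gamma> k (2 * i + 1))\<^sup>2" for i
    using power_even_eq[of \<gamma> i] by (simp add: power2_eq_square mult_ac)
  have even_term: "?f (2 * i + 2) = (\<gamma> ^ (i + 1) * walk \<gamma> k (2 * i + 2))\<^sup>2" for i
    by (simp add: power2_eq_square power_mult mult_ac)
  \<comment> \<open>The strict bound in \<open>walk_orthogonality\<close> forces the cutoff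
    \<open>Suc (2 * k)\<close>; its top term is zero.\<close>
  have "walk \<gamma> (2 * k) 0 = (\<Sum>s\<le>Suc (2 * k). ?f s)"
    by (subst walk_orthogonality) (auto simp: mult_2)
  also have "\<dots> = (\<Sum>s\<le>2 * k. ?f s)"
    by (simp add: walk_eq_0 del: power_Suc)
  also have "\<dots> = (walk \<gamma> k 0)\<^sup>2 + (\<Sum>s<2 * k. ?f (Suc s))"
    unfolding lessThan_Suc_atMost[symmetric] sum.lessThan_Suc_shift by (simp add: power2_eq_square)
  also have "(\<Sum>s<2 * k. ?f (Suc s)) = (\<Sum>i<k. ?f (2 * i + 1) + ?f (2 * i + 2))"
    by (rule pair)
  also have "\<dots> = \<gamma> * (\<Sum>i<k. (\<gamma> ^ i * walk \<gamma> k (2 * i + 1))\<^sup>2)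
      + (\<Sum>i<k. (\<gamma> ^ (i + 1) * walk \<gamma> k (2 * i + 2))\<^sup>2)"
    by (simp only: odd_term even_term sum.distrib sum_distrib_left)
  finally show ?thesis by simp
qed

lemma expectation_AM_pmf:
  assumes "\<gamma> > 0"
  shows "measure_pmf.expectation (AM_pmf k \<gamma>) f =
    (\<Sum>p\<in>AM k. \<gamma> ^ rises p * f p) / (\<Sum>p\<in>AM k. \<gamma> ^ rises p)"
  by (subst integral_measure_pmf_real[OF finite_AM[of k]])
    (auto simp: pmf_AM_pmf[OF assms] set_pmf_iff sum_divide_distrib mult_ac split: if_splits)

theorem theorem3:
  fixes k :: nat and \<gamma> :: real
  assumes "k \<ge> 1" and "\<gamma> > 0"
  shows
    "(L2_set (\<lambda>i. measure_pmf.expectation (AM_pmf k \<gamma>) (\<lambda>p. real (R i p))) {0..k-1})\<^sup>2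
       + \<gamma> * (L2_set (\<lambda>i. measure_pmf.expectation (AM_pmf k \<gamma>) (\<lambda>p. real (L i p))) {0..k-1})\<^sup>2
     = 1 / (narayana k \<gamma>)\<^sup>2 *
         (\<Sum>p\<^sub>1\<in>AM k. \<Sum>p\<^sub>2\<in>AM k. \<gamma> ^ (rises p\<^sub>1 + rises p\<^sub>2) *
            ((\<Sum>i=0..k-1. real (R i p\<^sub>1) * real (R i p\<^sub>2))
              + \<gamma> * (\<Sum>i=0..k-1. real (L i p\<^sub>1) * real (L i p\<^sub>2))))
     \<and> 1 / (narayana k \<gamma>)\<^sup>2 *
         (\<Sum>p\<^sub>1\<in>AM k. \<Sum>p\<^sub>2\<in>AM k. \<gamma> ^ (rises p\<^sub>1 + rises p\<^sub>2) *
            ((\<Sum>i=0..k-1. real (R i p\<^sub>1) * real (R i p\<^sub>2))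
              + \<gamma> * (\<Sum>i=0..k-1. real (L i p\<^sub>1) * real (L i p\<^sub>2))))
       = narayana (2 * k) \<gamma> / (narayana k \<gamma>)\<^sup>2 - 1"
proof -
  let ?S = "\<Sum>p\<^sub>1\<in>AM k. \<Sum>p\<^sub>2\<in>AM k. \<gamma> ^ (rises p\<^sub>1 + rises p\<^sub>2) *
            ((\<Sum>i=0..k-1. real (R i p\<^sub>1) * real (R i p\<^sub>2))
              + \<gamma> * (\<Sum>i=0..k-1. real (L i p\<^sub>1) * real (L i p\<^sub>2)))"
  \<comment> \<open>At \<open>m = 0\<close> the two sides differ: the empty sum is 0 but
    \<open>walk \<gamma> 0 0\<close> is 1.\<close>
  have nar: "narayana m \<gamma> = walk \<gamma> m 0" if "m \<ge> 1" for m
    using that walk_narayana[of \<gamma> "m - 1"] by (simp del: walk.simps)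
  have Z: "(\<Sum>p\<in>AM k. \<gamma> ^ rises p) = narayana k \<gamma>"
    using assms by (simp add: nar AM_eq_paths sum_paths_weight)
  have "(\<Sum>p\<in>AM k. \<gamma> ^ rises p) > 0"
    using assms by (intro sum_pos finite_AM AM_nonempty) auto
  then have Z_pos: "narayana k \<gamma> > 0" by (simp add: Z)
  have I: "{0..k-1} = {..<k}"
    using assms by auto
  \<comment> \<open>Independent copies: each squared weighted sum expands into a double sum over
    pairs of paths.\<close>
  have sq: "(\<Sum>p\<^sub>1\<in>AM k. \<Sum>p\<^sub>2\<in>AM k. \<gamma> ^ (rises p\<^sub>1 + rises p\<^sub>2) *
        (\<Sum>i<k. real (X i p\<^sub>1) * real (X i p\<^sub>2))) = (\<Sum>i<k. (\<Sum>p\<in>AM k. \<gamma> ^ rises p * real (X i p))\<^sup>2)"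
    for X :: "nat \<Rightarrow> path_step list \<Rightarrow> nat"
  proof -
    have "(\<Sum>i<k. (\<Sum>p\<in>AM k. \<gamma> ^ rises p * real (X i p))\<^sup>2) =
       (\<Sum>i<k. \<Sum>p\<^sub>1\<in>AM k. \<Sum>p\<^sub>2\<in>AM k. \<gamma> ^ (rises p\<^sub>1 + rises p\<^sub>2) * (real (X i p\<^sub>1) * real (X i p\<^sub>2)))"
      by (simp add: power2_eq_square sum_product power_add mult_ac)
    also have "\<dots> = (\<Sum>p\<^sub>1\<in>AM k. \<Sum>p\<^sub>2\<in>AM k. \<Sum>i<k.
        \<gamma> ^ (rises p\<^sub>1 + rises p\<^sub>2) * (real (X i p\<^sub>1) * real (X i p\<^sub>2)))"
      by (subst sum.swap, subst sum.swap[of _ "{..<k}"]) simp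
    finally show ?thesis by (simp add: sum_distrib_left)
  qed
  have "?S = (\<Sum>p\<^sub>1\<in>AM k. \<Sum>p\<^sub>2\<in>AM k. \<gamma> ^ (rises p\<^sub>1 + rises p\<^sub>2) *
        (\<Sum>i<k. real (R i p\<^sub>1) * real (R i p\<^sub>2))) + \<gamma> * (\<Sum>p\<^sub>1\<in>AM k. \<Sum>p\<^sub>2\<in>AM k. \<gamma> ^ (rises p\<^sub>1 + rises p\<^sub>2) *
        (\<Sum>i<k. real (L i p\<^sub>1) * real (L i p\<^sub>2)))"
    unfolding I by (simp only: distrib_left sum.distrib sum_distrib_left mult.left_commute)
  then have S: "?S = (\<Sum>i<k. (\<Sum>p\<in>AM k. \<gamma> ^ rises p * real (R i p))\<^sup>2)
      + \<gamma> * (\<Sum>i<k. (\<Sum>p\<in>AM k. \<gamma> ^ rises p * real (L i p))\<^sup>2)"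
    by (simp only: sq)
  have "?S = narayana (2 * k) \<gamma> - (narayana k \<gamma>)\<^sup>2"
    using assms unfolding S sum_AM_R sum_AM_L sum_walk_squares by (simp add: nar)
  then have "1 / (narayana k \<gamma>)\<^sup>2 * ?S = narayana (2 * k) \<gamma> / (narayana k \<gamma>)\<^sup>2 - 1"
    using Z_pos by (simp add: field_simps)
  moreover have "(L2_set (\<lambda>i. measure_pmf.expectation (AM_pmf k \<gamma>) (\<lambda>p. real (X i p))) {0..k-1})\<^sup>2 =
      1 / (narayana k \<gamma>)\<^sup>2 * (\<Sum>i<k. (\<Sum>p\<in>AM k. \<gamma> ^ rises p * real (X i p))\<^sup>2)"
    for X :: "nat \<Rightarrow> path_step list \<Rightarrow> nat"
    unfolding L2_set_def I expectation_AM_pmf[OF assms(2)] Z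
    by (simp add: sum_nonneg power_divide flip: sum_divide_distrib)
  ultimately show ?thesis
    unfolding S by (simp add: algebra_simps)
qed

end
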